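(* Let $(C,E)$ be a refinement tree on $\{1,\dots,n\}$, let $V^H\in\mathbb{R}^{n\times p}$ be a coarse basis whose columns $v^H_1,\dots,v^H_p$ are associated with nodes $d_1,\dots,d_p$ of the tree, and let $V^h\in\mathbb{R}^{n\times q}$ be the fine basis obtained by splitting all columns of $V^H$ according to the children of their nodes (all as defined in the context). Then the refinement method generates a hierarchy of subspaces, in the sense that $$\mathrm{range}(V^H)\subseteq\mathrm{range}(V^h).$$
   Context: Notation: $\mathcal P(S)$ is the power set of $S$, and $\mathrm{range}(A)$ is the column space of a matrix $A$. Refinement tree: a finite rooted tree with node set $\{1,\dots,m\}$ and root $1$, given by a child function $C:\{1,\dots,m\}\to\mathcal P(\{1,\dots,m\})$ ($C(i)$ is the set of children of node $i$; $i$ is a leaf if $C(i)=\emptyset$) and an element function $E:\{1,\dots,m\}\to\mathcal P(\{1,\dots,n\})$, such that: (1) $E(1)=\{1,\dots,n\}$; (2) for every non-leaf node $i$, the sets $E(j)$, $j\in C(i)$, are pairwise disjoint and $\bigcup_{j\in C(i)}E(j)=E(i)$; (3) for every $l\in\{1,\dots,n\}$ there is a node $i$ with $E(i)=\{l\}$ and $C(i)=\emptyset$. Coarse basis: $V^H=[v^H_1\ \cdots\ v^H_p]\in\mathbb{R}^{n\times p}$, where each column $v^H_i$ is associated with a node $d_i\in\{1,\dots,m\}$ and the entries of $v^H_i$ vanish outside $E(d_i)$. Fine basis: every column $v^H_i$ whose node $d_i$ is not a leaf is replaced by $q_i=\mathrm{card}(C(d_i))$ columns, one for each child $k\in C(d_i)$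 (ordered increasingly), namely the vector having the same entries as $v^H_i$ at indices in $E(k)$ and zeros elsewhere; a column whose node is a leaf cannot be split and is kept unchanged ($q_i=1$). The resulting matrix is $V^h\in\mathbb{R}^{n\times q}$ with $q=\sum_{i=1}^p q_i$, the $j$th column arising from $v^H_i$ having index $\sum_{k<i}q_k+j$. The prolongation operator is the matrix $I_H^h\in\{0,1\}^{q\times p}$ whose $(a,i)$ entry is $1$ if column $a$ of $V^h$ arises from $v^H_i$ and $0$ otherwise; coarse and fine bases are related by $V^H=V^hI_H^h$. *)

theory Defs
  imports "HOL-Library.Disjoint_Sets" "Jordan_Normal_Form.VS_Connect"
begin

text \<open>
  Nodes, elements and the columns of the coarse basis are numbered from 1, whereas rows and columns
  of the matrix type are numbered from 0: cell \<open>(r, c)\<close> of a matrix is its entry in row \<open>Suc r\<close> and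
  column \<open>Suc c\<close> in the numbering from 1. Child, element and node functions are total; only their
  values on \<open>{1..m}\<close> and \<open>{1..p}\<close>, respectively, matter.
\<close>

text \<open>
  Unique parents, no parent of the root, and reachability of every node from the root together
  exclude cycles.
\<close>

locale rooted_tree =
  fixes m :: nat and C :: "nat \<Rightarrow> nat set"
  assumes root_node: "1 \<in> {1..m}"
    and children_nodes: "i \<in> {1..m} \<Longrightarrow> C i \<subseteq> {1..m}"
    and root_no_parent: "i \<in> {1..m} \<Longrightarrow> 1 \<notin> C i"
    and unique_parent: "j \<in> {1..m} \<Longrightarrow> j \<noteq> 1 \<Longrightarrow> \<exists>!i. i \<in> {1..m} \<and> j \<in> C i"
    and reachable: "j \<in> {1..m} \<Longrightarrow> (1, j) \<in> {(i, k). i \<in> {1..m} \<and> k \<in> C i}\<^sup>*"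

locale refinement_tree = rooted_tree m C
  for m :: nat and C :: "nat \<Rightarrow> nat set" +
  fixes n :: nat and E :: "nat \<Rightarrow> nat set"
  assumes elements: "i \<in> {1..m} \<Longrightarrow> E i \<subseteq> {1..n}"
    and root_elements: "E 1 = {1..n}"
    and children_disjoint: "i \<in> {1..m} \<Longrightarrow> C i \<noteq> {} \<Longrightarrow> disjoint_family_on E (C i)"
    and children_cover: "i \<in> {1..m} \<Longrightarrow> C i \<noteq> {} \<Longrightarrow> (\<Union>j\<in>C i. E j) = E i"
    and singleton_leaf: "l \<in> {1..n} \<Longrightarrow> \<exists>i\<in>{1..m}. E i = {l} \<and> C i = {}"

definition coarse_basis ::
    "nat \<Rightarrow> nat \<Rightarrow> (nat \<Rightarrow> nat set) \<Rightarrow> nat \<Rightarrow> (nat \<Rightarrow> nat) \<Rightarrow> real mat \<Rightarrow> bool" where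
  "coarse_basis m n E p d V \<longleftrightarrow>
     V \<in> carrier_mat n p \<and>
     (\<forall>i\<in>{1..p}. d i \<in> {1..m}) \<and>
     (\<forall>r<n. \<forall>c<p. Suc r \<notin> E (d (Suc c)) \<longrightarrow> V $$ (r, c) = 0)"

definition restrict_vec :: "nat set \<Rightarrow> real vec \<Rightarrow> real vec" where
  "restrict_vec S v = vec (dim_vec v) (\<lambda>r. if Suc r \<in> S then v $ r else 0)"

definition split_column ::
    "(nat \<Rightarrow> nat set) \<Rightarrow> (nat \<Rightarrow> nat set) \<Rightarrow> nat \<Rightarrow> real vec \<Rightarrow> real vec list" where
  "split_column C E i v =
     (if C i = {} then [v] else map (\<lambda>k. restrict_vec (E k) v) (sorted_list_of_set (C i)))"

definition fine_basis ::
    "(nat \<Rightarrow> nat set) \<Rightarrow> (nat \<Rightarrow> nat set) \<Rightarrow> (nat \<Rightarrow> nat) \<Rightarrow> real mat \<Rightarrow> real mat" where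
  "fine_basis C E d V =
     mat_of_cols (dim_row V)
       (concat (map (\<lambda>c. split_column C E (d (Suc c)) (col V c)) [0..<dim_col V]))"

definition split_count :: "(nat \<Rightarrow> nat set) \<Rightarrow> nat \<Rightarrow> nat" where
  "split_count C i = (if C i = {} then 1 else card (C i))"

lemma length_split_column [simp]: "length (split_column C E i v) = split_count C i"
  by (simp add: split_column_def split_count_def)

lemma dim_split_column: "w \<in> set (split_column C E i v) \<Longrightarrow> dim_vec w = dim_vec v"
  by (auto simp: split_column_def restrict_vec_def split: if_splits)

lemma nth_concat_map_upt:
  assumes "c < p" "j < length (f c)"
  shows "(\<Sum>k<c. length (f k)) + j < length (concat (map f [0..<p]))"
    and "concat (map f [0..<p]) ! ((\<Sum>k<c. length (f k)) + j) = f c ! j"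
proof -
  have len: "length (concat (map f [0..<c])) = (\<Sum>k<c. length (f k))"
    by (induction c) auto
  have "[0..<p] = [0..<c] @ c # [Suc c..<p]"
    using upt_add_eq_append[of 0 c "p - c"] upt_conv_Cons[OF assms(1)] assms(1) by simp
  then have split: "concat (map f [0..<p]) =
      concat (map f [0..<c]) @ f c @ concat (map f [Suc c..<p])"
    by simp
  show "(\<Sum>k<c. length (f k)) + j < length (concat (map f [0..<p]))"
    unfolding split using len assms(2) by simp
  show "concat (map f [0..<p]) ! ((\<Sum>k<c. length (f k)) + j) = f c ! j"
    unfolding split len[symmetric] nth_append_length_plus using assms(2)
    by (simp add: nth_append)
qed

lemma fine_basis_carrier:
  assumes "V \<in> carrier_mat n p"
  shows "fine_basis C E d V \<in> carrier_mat n (\<Sum>i=1..p. split_count C (d i))"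
proof -
  have len: "length (concat (map (\<lambda>c. split_column C E (d (Suc c)) (col V c)) [0..<p]))
      = (\<Sum>i=1..p. split_count C (d i))"
    by (induction p) auto
  from assms have "dim_row V = n" "dim_col V = p"
    by auto
  then show ?thesis
    unfolding fine_basis_def len[symmetric] by (simp only: mat_of_cols_carrier)
qed

lemma col_fine_basis:
  assumes "V \<in> carrier_mat n p" "c < p" "j < split_count C (d (Suc c))"
  shows "col (fine_basis C E d V) ((\<Sum>k<c. split_count C (d (Suc k))) + j) =
    split_column C E (d (Suc c)) (col V c) ! j"
proof -
  define f where "f = (\<lambda>c. split_column C E (d (Suc c)) (col V c))"
  have len: "length (f k) = split_count C (d (Suc k))" for k
    by (simp add: f_def)
  from assms(3) have j: "j < length (f c)"
    by (simp only: len)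
  have fine: "fine_basis C E d V = mat_of_cols n (concat (map f [0..<p]))"
    using assms(1) by (simp add: fine_basis_def f_def)
  have "f c ! j \<in> set (split_column C E (d (Suc c)) (col V c))"
    using nth_mem[OF j] by (simp only: f_def)
  from dim_split_column[OF this] have "f c ! j \<in> carrier_vec n"
    using assms(1) by (intro carrier_vecI) simp
  then have "col (fine_basis C E d V) ((\<Sum>k<c. length (f k)) + j) = f c ! j"
    unfolding fine using nth_concat_map_upt[where f = f, OF assms(2) j] by (metis col_mat_of_cols)
  then show ?thesis
    by (simp only: len) (simp only: f_def)
qed

end

theory Submission
  imports Defs
begin

text \<open>
  A column is the sum of its restrictions to the element sets of the children of its node, since
  these sets partition the element set of the node, outside of which the column vanishes.
\<close>

lemma restrict_vec_empty: "restrict_vec {} v = 0\<^sub>v (dim_vec v)"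
  by (auto simp: restrict_vec_def)

lemma restrict_vec_Un:
  assumes "A \<inter> B = {}"
  shows "restrict_vec (A \<union> B) v = restrict_vec A v + restrict_vec B v"
  using assms by (intro eq_vecI) (auto simp: restrict_vec_def)

lemma restrict_vec_idem:
  assumes "\<And>r. r < dim_vec v \<Longrightarrow> Suc r \<notin> S \<Longrightarrow> v $ r = 0"
  shows "restrict_vec S v = v"
  using assms by (auto simp: restrict_vec_def)

text \<open>Induction on \<open>K\<close>: disjointness turns the restriction to the enlarged union
  into a sum of two vectors of the span. Asserting membership in the span, rather than an equation
  with an indexed vector sum, leaves only closure under zero and addition to use.\<close>

lemma restrict_vec_UN_mem_span:
  assumes "finite K" "disjoint_family_on E K" "v \<in> carrier_vec n" "S \<subseteq> carrier_vec n"
    and "\<And>k. k \<in> K \<Longrightarrow>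
      restrict_vec (E k) v \<in> LinearCombinations.module.span class_ring (module_vec TYPE(real) n) S"
  shows "restrict_vec (\<Union>k\<in>K. E k) v
    \<in> LinearCombinations.module.span class_ring (module_vec TYPE(real) n) S"
proof -
  interpret vec_space "TYPE(real)" n .
  show ?thesis
    using assms(1,2,5)
  proof (induction K)
    case empty
    show ?case
      using span_zero[of S] assms(3) by (simp add: restrict_vec_empty)
  next
    case (insert k K)
    \<comment> \<open>Disjointness of the family concerns distinct indices only, hence the appeal to
      \<open>k \<notin> K\<close>.\<close>
    have disj: "E k \<inter> (\<Union>i\<in>K. E i) = {}"
      using insert.prems(1) insert.hyps(2) by (fastforce simp: disjoint_family_on_def)
    have "restrict_vec (\<Union>i\<in>K. E i) v \<in> span S"
      using insert.prems by (intro insert.IH) (auto simp: disjoint_family_on_def)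
    with insert.prems(2)[of k] have "restrict_vec (E k) v + restrict_vec (\<Union>i\<in>K. E i) v \<in> span S"
      using span_add1[of S] assms(4) by simp
    then show ?case
      by (simp add: restrict_vec_Un[OF disj])
  qed
qed

theorem lemma1:
  fixes m n p :: nat and C E :: "nat \<Rightarrow> nat set" and d :: "nat \<Rightarrow> nat" and VH Vh :: "real mat"
  assumes "refinement_tree m C n E"
    and "coarse_basis m n E p d VH"
    and "Vh = fine_basis C E d VH"
  shows "vec_space.col_space n VH \<subseteq> vec_space.col_space n Vh"
proof -
  interpret refinement_tree m C n E by fact
  interpret vec_space "TYPE(real)" n .
  have VH: "VH \<in> carrier_mat n p"
    and node: "c < p \<Longrightarrow> d (Suc c) \<in> {1..m}"
    and vanish: "r < n \<Longrightarrow> c < p \<Longrightarrow> Suc r \<notin> E (d (Suc c)) \<Longrightarrow> VH $$ (r, c) = 0" for r c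
    using assms(2) by (auto simp: coarse_basis_def)
  have Vh: "set (cols Vh) \<subseteq> carrier_vec n"
    using cols_dim[of Vh] fine_basis_carrier[OF VH, of C E d] assms(3) by (metis carrier_matD(1))
  have split_mem: "w \<in> span (set (cols Vh))"
    if c: "c < p" and w: "w \<in> set (split_column C E (d (Suc c)) (col VH c))" for w c
  proof -
    let ?ws = "concat (map (\<lambda>c. split_column C E (d (Suc c)) (col VH c)) [0..<p])"
    \<comment> \<open>Once all listed vectors have dimension \<open>n\<close>, \<open>cols\<close>
      recovers the list from which \<open>mat_of_cols\<close> built \<open>Vh\<close>.\<close>
    have "set ?ws \<subseteq> carrier_vec n"
      using VH by (auto intro!: carrier_vecI dest!: dim_split_column)
    then have "cols Vh = ?ws"
      using VH assms(3) by (simp add: fine_basis_def)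
    with c w have "w \<in> set (cols Vh)"
      by auto
    \<comment> \<open>Folding rewrites \<open>carrier_vec n\<close> as the carrier of the module,
      the form in which \<open>span_mem\<close> takes its premise.\<close>
    then show ?thesis
      by (rule span_mem[OF Vh[folded module_vec_simps(3)]])
  qed
  have col_mem: "col VH c \<in> span (set (cols Vh))" if c: "c < p" for c
  proof (cases "C (d (Suc c)) = {}")
    \<comment> \<open>The column of a leaf is kept unsplit, so it is itself a column of
      \<open>Vh\<close>.\<close>
    case True
    then show ?thesis
      using split_mem[OF c, of "col VH c"] by (simp add: split_column_def)
  next
    case False
    let ?K = "C (d (Suc c))"
    \<comment> \<open>Finiteness serves twice: for the induction over the children, and because
      \<open>sorted_list_of_set\<close> lists exactly the elements of a finite set.\<close>
    have fin: "finite ?K"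
      using children_nodes[OF node[OF c]] finite_subset by blast
    have "restrict_vec (\<Union>k\<in>?K. E k) (col VH c) \<in> span (set (cols Vh))"
    proof (rule restrict_vec_UN_mem_span[OF fin children_disjoint[OF node[OF c] False] _ Vh])
      show "col VH c \<in> carrier_vec n"
        using VH c by auto
      show "restrict_vec (E k) (col VH c) \<in> span (set (cols Vh))" if "k \<in> ?K" for k
        using that False fin by (intro split_mem[OF c]) (simp add: split_column_def)
    qed
    moreover have "restrict_vec (E (d (Suc c))) (col VH c) = col VH c"
      using VH c vanish by (intro restrict_vec_idem) auto
    ultimately show ?thesis
      by (simp add: children_cover[OF node[OF c] False])
  qed
  have "set (cols VH) \<subseteq> span (set (cols Vh))"
    using VH col_mem by (auto simp: cols_def)
  \<comment> \<open>A column space is the span of the columns, and a span that contains these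
    generators contains everything they span.\<close>
  then show ?thesis
    unfolding col_space_def by (rule span_subsetI[OF Vh])
qed

end
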